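(* Let $\mathbf{G}$ be an abelian group, let $A,B\subseteq\mathbf{G}$ be finite sets with $A$ nonempty, and let $k,l$ be positive integers. Then, for each of the two choices of the sign $\pm$, $$|A|^{2l}\,\mathsf{E}_{k+1}(B,A)^2\le\mathsf{E}_{k+l+1}(B,A)\cdot\sum_{x\in\mathbf{G}^k}\left|A^l\pm\Delta_l(A^B_x)\right|\,|A^B_x|^2$$ and $$|A|^{2l}\sum_{x\in\mathbf{G}^k:\ A^B_x\ne\emptyset}\frac{|A^B_x|^2}{\left|A^l\pm\Delta_l(A^B_x)\right|}\le\mathsf{E}_{k+l+1}(B,A).$$
   Context: For $x=(x_1,\dots,x_k)\in\mathbf{G}^k$ put $A^B_x=B\cap(A-x_1)\cap\dots\cap(A-x_k)$. For a set $S\subseteq\mathbf{G}$, $\Delta_l(S)=\{(s,s,\dots,s)\in\mathbf{G}^l: s\in S\}$. $A^l\subseteq\mathbf{G}^l$ is the Cartesian power, and $A^l\pm\Delta_l(S)=\{a\pm d: a\in A^l,\ d\in\Delta_l(S)\}$. For a finite set $S$, $(S\circ S)(x)=|\{(s,s')\in S\times S: s'-s=x\}|$. The higher energy is $\mathsf{E}_m(B,A)=\sum_{x\in\mathbf{G}}(B\circ B)(x)\,(A\circ A)(x)^{m-1}$. *)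

theory Defs
  imports "HOL-Analysis.Infinite_Sum" "HOL-Library.FuncSet"
begin

text \<open>
  The ambient group is the whole type \<open>'a :: ab_group_add\<close>.  For \<open>S\<close> a set in it, the power \<open>S\<^sup>n\<close>
  is the set of extensional functions on \<open>{..<n}\<close> with values in \<open>S\<close>, so coordinates are numbered
  from \<open>0\<close>.  The ambient group may be infinite, so sums over it and its powers are written
  with \<^const>\<open>infsum\<close>; the lemmas below show that they have only finitely many nonzero terms.
\<close>

definition cpow :: "'a set \<Rightarrow> nat \<Rightarrow> (nat \<Rightarrow> 'a) set" where
  "cpow S n = {..<n} \<rightarrow>\<^sub>E S"

definition diag :: "nat \<Rightarrow> 'a set \<Rightarrow> (nat \<Rightarrow> 'a) set" where
  "diag l S = {\<lambda>i\<in>{..<l}. s | s. s \<in> S}"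

text \<open>Here \<open>pm\<close> stands for either of the group operations \<open>(+)\<close> and \<open>(-)\<close>.\<close>

definition set_op :: "('a \<Rightarrow> 'a \<Rightarrow> 'a) \<Rightarrow> nat \<Rightarrow> (nat \<Rightarrow> 'a) set \<Rightarrow> (nat \<Rightarrow> 'a) set \<Rightarrow> (nat \<Rightarrow> 'a) set" where
  "set_op pm l X Y = {\<lambda>i\<in>{..<l}. pm (a i) (d i) | a d. a \<in> X \<and> d \<in> Y}"

definition shift_inter :: "'a::ab_group_add set \<Rightarrow> 'a set \<Rightarrow> nat \<Rightarrow> (nat \<Rightarrow> 'a) \<Rightarrow> 'a set" where
  "shift_inter A B k x = B \<inter> (\<Inter>i<k. (\<lambda>a. a - x i) ` A)"

definition corr :: "'a::ab_group_add set \<Rightarrow> 'a \<Rightarrow> nat" where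
  "corr S x = card {(s, s'). s \<in> S \<and> s' \<in> S \<and> s' - s = x}"

definition energy :: "nat \<Rightarrow> 'a::ab_group_add set \<Rightarrow> 'a set \<Rightarrow> real" where
  "energy m B A = (\<Sum>\<^sub>\<infinity>x\<in>UNIV. real (corr B x) * real (corr A x) ^ (m - 1))"

lemma finite_support_energy:
  assumes "finite B"
  shows "finite {x. real (corr B x) * real (corr A x) ^ (m - 1) \<noteq> 0}"
proof (rule finite_subset)
  show "{x. real (corr B x) * real (corr A x) ^ (m - 1) \<noteq> 0} \<subseteq> (\<lambda>(s, s'). s' - s) ` (B \<times> B)"
  proof
    fix x assume "x \<in> {x. real (corr B x) * real (corr A x) ^ (m - 1) \<noteq> 0}"
    then have "card {(s, s'). s \<in> B \<and> s' \<in> B \<and> s' - s = x} \<noteq> 0"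
      by (simp add: corr_def)
    then have "{(s, s'). s \<in> B \<and> s' \<in> B \<and> s' - s = x} \<noteq> {}"
      by (metis card.empty)
    then show "x \<in> (\<lambda>(s, s'). s' - s) ` (B \<times> B)"
      by force
  qed
qed (use assms in simp)

lemma finite_support_shift_inter:
  fixes A B :: "'a::ab_group_add set"
  assumes "finite A" "finite B"
  shows "finite {x \<in> cpow UNIV k. shift_inter A B k x \<noteq> {}}"
proof (rule finite_subset)
  show "{x \<in> cpow UNIV k. shift_inter A B k x \<noteq> {}}
    \<subseteq> {..<k} \<rightarrow>\<^sub>E (\<lambda>(a, b). a - b) ` (A \<times> B)"
  proof
    fix x assume x: "x \<in> {x \<in> cpow UNIV k. shift_inter A B k x \<noteq> {}}"
    then obtain b where b: "b \<in> B" "\<And>i. i < k \<Longrightarrow> b \<in> (\<lambda>a. a - x i) ` A"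
      by (auto simp: shift_inter_def)
    have "x i \<in> (\<lambda>(a, b). a - b) ` (A \<times> B)" if i: "i < k" for i
    proof -
      obtain a where "a \<in> A" "b = a - x i" using b(2)[OF i] by blast
      then show ?thesis using b(1) by (intro image_eqI[of _ _ "(a, b)"]) auto
    qed
    then show "x \<in> {..<k} \<rightarrow>\<^sub>E (\<lambda>(a, b). a - b) ` (A \<times> B)"
      using x by (auto simp: cpow_def PiE_iff)
  qed
  show "finite ({..<k} \<rightarrow>\<^sub>E (\<lambda>(a, b). a - b) ` (A \<times> B))"
    using assms by (intro finite_PiE) auto
qed

end

theory Submission
  imports Defs "HOL-Analysis.Convex"
begin

text \<open>
  Let \<open>S\<close> be a finite set. Applying the Cauchy--Schwarz inequality to the fibres of the map
  \<open>(a, s) \<mapsto> a \<plusminus> (s, \<dots>, s)\<close> on \<open>A\<^sup>l \<times> S\<close> gives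
  \<open>|A|\<^sup>2\<^sup>l |S|\<^sup>2 \<le> |A\<^sup>l \<plusminus> \<Delta>\<^sub>l(S)| F(S)\<close>, where \<open>F(S) = \<Sum>s,s'\<in>S. (A \<circ> A)(s' - s)\<^sup>l\<close> counts
  the collisions. Summing \<open>F\<close> over the sets \<open>A\<^sup>B\<^sub>x\<close> and exchanging the order of
  summation yields exactly \<open>E\<^bsub>k+l+1\<^esub>(B, A)\<close>, because a pair \<open>s, s'\<close> of elements of \<open>B\<close> lies in
  \<open>A\<^sup>B\<^sub>x\<close> for \<open>(A \<circ> A)(s' - s)\<^sup>k\<close> values of \<open>x\<close>. This is the second inequality; the first one
  follows by another application of Cauchy--Schwarz, since the case \<open>l = 0\<close> of the exchange reads
  \<open>\<Sum>x. |A\<^sup>B\<^sub>x|\<^sup>2 = E\<^bsub>k+1\<^esub>(B, A)\<close>.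
\<close>

text \<open>The fibres of \<open>f\<close> partition \<open>P\<close>: their sizes add up to the
  cardinality of \<open>P\<close>, and the squares of their sizes to the number of
  collisions.\<close>

lemma card_square_le_collisions:
  assumes "finite P"
  shows "real (card P) ^ 2 \<le> real (card (f ` P)) * real (card {(p, q). p \<in> P \<and> q \<in> P \<and> f p = f q})"
proof -
  define n where "n y = card {p \<in> P. f p = y}" for y
  have "card P = (\<Sum>y\<in>f ` P. n y)"
    using sum_fun_comp[of P "f ` P" f "\<lambda>_. 1::nat"] assms by (simp add: n_def)
  moreover have "card {(p, q). p \<in> P \<and> q \<in> P \<and> f p = f q} = (\<Sum>y\<in>f ` P. n y ^ 2)"
  proof -
    have "{(p, q). p \<in> P \<and> q \<in> P \<and> f p = f q} = (\<Union>y\<in>f ` P. {p \<in> P. f p = y} \<times> {p \<in> P. f p = y})"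
      by auto
    also have "card \<dots> = (\<Sum>y\<in>f ` P. card ({p \<in> P. f p = y} \<times> {p \<in> P. f p = y}))"
      using assms by (intro card_UN_disjoint) auto
    finally show ?thesis by (simp add: n_def card_cartesian_product power2_eq_square)
  qed
  ultimately show ?thesis
    using sum_squared_le_sum_of_squares[of "\<lambda>y. real (n y)" "f ` P"]
    by (simp add: mult.commute)
qed

lemma corr_eq_card: "corr S x = card {s \<in> S. s + x \<in> S}"
proof -
  have "{(s, s'). s \<in> S \<and> s' \<in> S \<and> s' - s = x} = (\<lambda>s. (s, s + x)) ` {s \<in> S. s + x \<in> S}"
    by (auto simp: image_iff algebra_simps)
  moreover have "inj_on (\<lambda>s. (s, s + x)) {s \<in> S. s + x \<in> S}"
    by (auto simp: inj_on_def)
  ultimately show ?thesis by (simp add: corr_def card_image)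
qed

lemma corr_uminus: "corr S (- x) = corr S x"
proof -
  have "{s \<in> S. s + - x \<in> S} = (\<lambda>s. s + x) ` {s \<in> S. s + x \<in> S}"
    by (auto simp: image_iff) (metis diff_add_cancel)
  then show ?thesis by (simp add: corr_eq_card card_image)
qed

lemma corr_minus_commute: "corr S (x - y) = corr S (y - x)"
  using corr_uminus[of S "x - y"] by simp

text \<open>Put \<open>a = s + z\<close>: then \<open>s' + z = a + (s' - s)\<close>.\<close>

lemma card_translates_meeting: "card {z. s + z \<in> A \<and> s' + z \<in> A} = corr A (s' - s)"
proof -
  have "{a \<in> A. a + (s' - s) \<in> A} = (\<lambda>z. s + z) ` {z. s + z \<in> A \<and> s' + z \<in> A}"
    by (auto simp: image_iff algebra_simps) (metis add.commute diff_add_cancel add_diff_eq)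
  then show ?thesis by (simp add: corr_eq_card card_image)
qed

text \<open>Group the pairs of \<open>B \<times> B\<close> by their difference \<open>x\<close>,
  which occurs \<open>corr B x\<close> times. As a sum over pairs, the energy is ready for the
  exchange of summation.\<close>

lemma energy_eq_sum:
  assumes "finite B"
  shows "energy m B A = (\<Sum>(s, s')\<in>B \<times> B. real (corr A (s' - s)) ^ (m - 1))"
proof -
  let ?d = "\<lambda>(s, s'). s' - s"
  have corr_B: "corr B y = card {p \<in> B \<times> B. ?d p = y}" for y
    unfolding corr_def by (rule arg_cong[where f = card]) auto
  have "energy m B A = (\<Sum>\<^sub>\<infinity>x\<in>?d ` (B \<times> B). real (corr B x) * real (corr A x) ^ (m - 1))"
    unfolding energy_def
  proof (rule infsum_cong_neutral)
    fix x assume "x \<in> UNIV - ?d ` (B \<times> B)"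
    then have "{p \<in> B \<times> B. ?d p = x} = {}" by blast
    then show "real (corr B x) * real (corr A x) ^ (m - 1) = 0" by (simp only: corr_B card.empty)
  qed auto
  also have "\<dots> = (\<Sum>x\<in>?d ` (B \<times> B). real (corr B x) * real (corr A x) ^ (m - 1))"
    using assms by (intro infsum_finite) simp
  also have "\<dots> = (\<Sum>p\<in>B \<times> B. real (corr A (?d p)) ^ (m - 1))"
    unfolding corr_B using assms by (intro sum_fun_comp[symmetric]) auto
  finally show ?thesis by (simp add: case_prod_unfold)
qed

text \<open>The coordinates of \<open>x\<close> are constrained independently: each
  \<open>x i\<close> must satisfy \<open>s + x i \<in> A\<close> and
  \<open>s' + x i \<in> A\<close>, which leaves \<open>corr A (s' - s)\<close> choices.\<close>

lemma card_shift_inter_containing: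
  assumes "s \<in> B" "s' \<in> B"
  shows "card {x \<in> cpow UNIV k. s \<in> shift_inter A B k x \<and> s' \<in> shift_inter A B k x}
    = corr A (s' - s) ^ k"
proof -
  have mem: "t \<in> (\<lambda>a. a - z) ` A \<longleftrightarrow> t + z \<in> A" for t z
    by (auto simp: image_iff) (metis add_diff_cancel)
  have "{x \<in> cpow UNIV k. s \<in> shift_inter A B k x \<and> s' \<in> shift_inter A B k x}
      = {..<k} \<rightarrow>\<^sub>E {z. s + z \<in> A \<and> s' + z \<in> A}"
    (is "?L = ?R")
  proof (rule set_eqI)
    fix x
    have "s \<in> shift_inter A B k x \<longleftrightarrow> (\<forall>i<k. s + x i \<in> A)"
      "s' \<in> shift_inter A B k x \<longleftrightarrow> (\<forall>i<k. s' + x i \<in> A)"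
      using assms unfolding shift_inter_def Int_iff INT_iff mem by auto
    then show "x \<in> ?L \<longleftrightarrow> x \<in> ?R"
      unfolding cpow_def PiE_iff by blast
  qed
  then show ?thesis by (simp add: card_PiE card_translates_meeting)
qed

text \<open>A collision forces \<open>b i = a i + c\<close> in every coordinate, with one constant
  \<open>c\<close>. So \<open>a\<close> determines \<open>b\<close>, and each \<open>a i\<close>
  ranges over the \<open>corr A c\<close> elements of \<open>A\<close> that \<open>c\<close>
  translates into \<open>A\<close>.\<close>

lemma card_power_collisions:
  fixes A :: "'a::ab_group_add set"
  assumes "pm = (+) \<or> pm = (-)"
  shows "card {(a, b). a \<in> cpow A l \<and> b \<in> cpow A l \<and>
      (\<lambda>i\<in>{..<l}. pm (a i) s) = (\<lambda>i\<in>{..<l}. pm (b i) s')} = corr A (s' - s) ^ l"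
proof -
  \<comment> \<open>The constant is \<open>s - s'\<close> for addition and \<open>s' - s\<close> for
    subtraction; \<open>corr A\<close> is even, so both signs give the same count.\<close>
  obtain c where c: "\<And>a b. pm a s = pm b s' \<longleftrightarrow> b = a + c" and corr_c: "corr A c = corr A (s' - s)"
  proof (cases "pm = (+)")
    case True
    show ?thesis
    proof (rule that[of "s - s'"])
      show "pm a s = pm b s' \<longleftrightarrow> b = a + (s - s')" for a b
        using True by (auto simp: algebra_simps)
    qed (rule corr_minus_commute)
  next
    case False
    then have "pm = (-)" using assms by blast
    then show ?thesis
      by (intro that[of "s' - s"]) (auto simp: algebra_simps)
  qed
  let ?g = "\<lambda>a. (a, \<lambda>i\<in>{..<l}. a i + c)"
  have "{(a, b). a \<in> cpow A l \<and> b \<in> cpow A l \<and>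
      (\<lambda>i\<in>{..<l}. pm (a i) s) = (\<lambda>i\<in>{..<l}. pm (b i) s')}
      = ?g ` ({..<l} \<rightarrow>\<^sub>E {a \<in> A. a + c \<in> A})" (is "?L = ?R")
  proof (intro equalityI subsetI)
    fix p assume "p \<in> ?L"
    then obtain a b where p: "p = (a, b)" and a: "a \<in> {..<l} \<rightarrow>\<^sub>E A" and b: "b \<in> {..<l} \<rightarrow>\<^sub>E A"
      and eq: "(\<lambda>i\<in>{..<l}. pm (a i) s) = (\<lambda>i\<in>{..<l}. pm (b i) s')"
      by (auto simp: cpow_def)
    have "b i = a i + c" if "i < l" for i
      using fun_cong[OF eq, of i] that c by simp
    \<comment> \<open>Outside \<open>{..<l}\<close> both functions take the value
      \<open>undefined\<close>.\<close>
    then have "b = (\<lambda>i\<in>{..<l}. a i + c)"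
      using b by (auto simp: PiE_iff extensional_def restrict_def)
    moreover have "a \<in> {..<l} \<rightarrow>\<^sub>E {a \<in> A. a + c \<in> A}"
      using a b \<open>\<And>i. i < l \<Longrightarrow> b i = a i + c\<close> by (fastforce simp: PiE_iff)
    ultimately show "p \<in> ?R" using p by blast
  next
    fix p assume "p \<in> ?R"
    then obtain a where p: "p = ?g a" and a: "a \<in> {..<l} \<rightarrow>\<^sub>E {a \<in> A. a + c \<in> A}"
      by blast
    have "a \<in> cpow A l" "(\<lambda>i\<in>{..<l}. a i + c) \<in> cpow A l"
      using a by (auto simp: cpow_def PiE_iff)
    moreover have "(\<lambda>i\<in>{..<l}. pm (a i) s) = (\<lambda>i\<in>{..<l}. pm ((\<lambda>i\<in>{..<l}. a i + c) i) s')"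
      by (rule restrict_ext) (simp add: c)
    ultimately show "p \<in> ?L" unfolding p by blast
  qed
  moreover have "inj_on ?g ({..<l} \<rightarrow>\<^sub>E {a \<in> A. a + c \<in> A})"
    by (auto simp: inj_on_def)
  ultimately show ?thesis
    by (simp add: card_image card_PiE flip: corr_c) (simp add: corr_eq_card)
qed

text \<open>The collision count \<open>F(S)\<close> of the introduction.\<close>

definition diag_energy :: "nat \<Rightarrow> 'a::ab_group_add set \<Rightarrow> 'a set \<Rightarrow> real" where
  "diag_energy l A S = (\<Sum>(s, s')\<in>S \<times> S. real (corr A (s' - s)) ^ l)"

lemma diag_energy_nonneg: "diag_energy l A S \<ge> 0"
  unfolding diag_energy_def by (intro sum_nonneg) auto

lemma card_set_op_diag_ge:
  fixes A S :: "'a::ab_group_add set"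
  assumes "finite A" "finite S" "pm = (+) \<or> pm = (-)"
  shows "(real (card A) ^ l * real (card S)) ^ 2
    \<le> real (card (set_op pm l (cpow A l) (diag l S))) * diag_energy l A S"
proof -
  let ?P = "cpow A l \<times> S"
  let ?f = "\<lambda>(a, s). \<lambda>i\<in>{..<l}. pm (a i) s"
  let ?C = "\<lambda>s s'. {(a, b). a \<in> cpow A l \<and> b \<in> cpow A l \<and>
      (\<lambda>i\<in>{..<l}. pm (a i) s) = (\<lambda>i\<in>{..<l}. pm (b i) s')}"
  have fin: "finite (cpow A l)" using assms by (simp add: cpow_def finite_PiE)
  have cardP: "card ?P = card A ^ l * card S"
    by (simp add: card_cartesian_product cpow_def card_PiE)
  have restr: "(\<lambda>i\<in>{..<l}. pm (a i) ((\<lambda>i\<in>{..<l}. s) i)) = (\<lambda>i\<in>{..<l}. pm (a i) s)" for a s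
    by (rule restrict_ext) simp
  have image: "set_op pm l (cpow A l) (diag l S) = ?f ` ?P" (is "?L = _")
  proof (intro equalityI subsetI)
    fix y assume "y \<in> ?L"
    then obtain a s where "a \<in> cpow A l" "s \<in> S" "y = (\<lambda>i\<in>{..<l}. pm (a i) ((\<lambda>i\<in>{..<l}. s) i))"
      unfolding set_op_def diag_def by blast
    then show "y \<in> ?f ` ?P" unfolding restr by (intro image_eqI[of _ _ "(a, s)"]) auto
  next
    fix y assume "y \<in> ?f ` ?P"
    then obtain a s where "a \<in> cpow A l" "s \<in> S" "y = (\<lambda>i\<in>{..<l}. pm (a i) s)"
      by auto
    then show "y \<in> ?L"
      unfolding set_op_def diag_def using restr[of a s, symmetric] by blast
  qed
  \<comment> \<open>Moving the two diagonal entries to the front fibres the collisions over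
    \<open>S \<times> S\<close>, and \<open>card_power_collisions\<close> counts each fibre.\<close>
  let ?h = "\<lambda>((a, s), (b, s')). ((s, s'), (a, b))"
  have "card {(p, q). p \<in> ?P \<and> q \<in> ?P \<and> ?f p = ?f q}
      = card (SIGMA (s, s'):S \<times> S. ?C s s')"
    by (rule bij_betw_same_card[of ?h], rule bij_betw_byWitness[where f' = "\<lambda>((s, s'), (a, b)). ((a, s), (b, s'))"])
      auto
  also have "\<dots> = (\<Sum>(s, s')\<in>S \<times> S. card (?C s s'))"
  proof -
    have "finite (?C s s')" for s s'
      using fin by (intro finite_subset[of "?C s s'" "cpow A l \<times> cpow A l"]) auto
    then show ?thesis
      using assms by (subst card_SigmaI) (auto simp: case_prod_unfold)
  qed
  finally have "real (card {(p, q). p \<in> ?P \<and> q \<in> ?P \<and> ?f p = ?f q}) = diag_energy l A S"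
    unfolding card_power_collisions[OF assms(3)] diag_energy_def by (simp add: case_prod_unfold)
  then show ?thesis
    using card_square_le_collisions[of ?P ?f] fin assms(2) by (simp add: cardP image)
qed

text \<open>Each pair from \<open>B \<times> B\<close> has weight \<open>corr A (s' - s) ^ l\<close>
  and is met by \<open>corr A (s' - s) ^ k\<close> values of \<open>x\<close>; the exponents add up
  to \<open>(k + l + 1) - 1\<close>.\<close>

lemma sum_diag_energy_shift_inter:
  fixes A B :: "'a::ab_group_add set"
  assumes "finite A" "finite B"
  shows "(\<Sum>x\<in>{x \<in> cpow UNIV k. shift_inter A B k x \<noteq> {}}. diag_energy l A (shift_inter A B k x))
    = energy (k + l + 1) B A"
proof -
  let ?S = "shift_inter A B k"
  let ?X = "{x \<in> cpow UNIV k. ?S x \<noteq> {}}"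
  let ?Q = "\<lambda>(s, s') x. s \<in> ?S x \<and> s' \<in> ?S x"
  let ?w = "\<lambda>(s, s'). real (corr A (s' - s)) ^ l"
  have finX: "finite ?X" by (rule finite_support_shift_inter[OF assms])
  have "diag_energy l A (?S x) = (\<Sum>p\<in>{p \<in> B \<times> B. ?Q p x}. ?w p)" for x
    unfolding diag_energy_def by (rule sum.cong) (auto simp: shift_inter_def)
  then have "(\<Sum>x\<in>?X. diag_energy l A (?S x)) = (\<Sum>x\<in>?X. \<Sum>p\<in>{p \<in> B \<times> B. ?Q p x}. ?w p)"
    by simp
  also have "\<dots> = (\<Sum>p\<in>B \<times> B. \<Sum>x\<in>{x \<in> ?X. ?Q p x}. ?w p)"
    using assms finX by (intro sum.swap_restrict) auto
  also have "\<dots> = (\<Sum>(s, s')\<in>B \<times> B. real (corr A (s' - s)) ^ (k + l))"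
  proof (rule sum.cong[OF refl])
    fix p assume "p \<in> B \<times> B"
    then obtain s s' where p: "p = (s, s')" and B: "s \<in> B" "s' \<in> B" by auto
    \<comment> \<open>A set containing \<open>s\<close> is nonempty, so the restriction to
      \<open>?X\<close> loses nothing.\<close>
    have "{x \<in> ?X. ?Q p x} = {x \<in> cpow UNIV k. s \<in> ?S x \<and> s' \<in> ?S x}"
      unfolding p by auto
    then have "card {x \<in> ?X. ?Q p x} = corr A (s' - s) ^ k"
      using card_shift_inter_containing[OF B] by simp
    then have "(\<Sum>x\<in>{x \<in> ?X. ?Q p x}. ?w p) = real (corr A (s' - s)) ^ k * ?w p"
      by (simp only: sum_constant of_nat_power)
    then show "(\<Sum>x\<in>{x \<in> ?X. ?Q p x}. ?w p) = (case p of (s, s') \<Rightarrow> real (corr A (s' - s)) ^ (k + l))"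
      unfolding p by (simp only: prod.case power_add)
  qed
  finally show ?thesis by (simp add: energy_eq_sum[OF assms(2)])
qed

theorem corollary17:
  fixes A B :: "'a::ab_group_add set" and k l :: nat and pm :: "'a \<Rightarrow> 'a \<Rightarrow> 'a"
  assumes "finite A" and "finite B" and "A \<noteq> {}" and "k \<ge> 1" and "l \<ge> 1"
    and "pm = (+) \<or> pm = (-)"
  shows "(real (card A) ^ (2 * l) * energy (k + 1) B A ^ 2
      \<le> energy (k + l + 1) B A *
        (\<Sum>\<^sub>\<infinity>x\<in>cpow UNIV k. real (card (set_op pm l (cpow A l) (diag l (shift_inter A B k x))))
                              * real (card (shift_inter A B k x)) ^ 2))
    \<and> (real (card A) ^ (2 * l) *
        (\<Sum>\<^sub>\<infinity>x\<in>{x \<in> cpow UNIV k. shift_inter A B k x \<noteq> {}}. real (card (shift_inter A B k x)) ^ 2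
            / real (card (set_op pm l (cpow A l) (diag l (shift_inter A B k x)))))
      \<le> energy (k + l + 1) B A)"
proof -
  let ?S = "shift_inter A B k"
  let ?X = "{x \<in> cpow UNIV k. ?S x \<noteq> {}}"
  let ?D = "\<lambda>x. real (card (set_op pm l (cpow A l) (diag l (?S x))))"
  let ?F = "\<lambda>x. diag_energy l A (?S x)"
  let ?N = "real (card A) ^ l"
  let ?E = "energy (k + l + 1) B A"
  have finX: "finite ?X" using assms by (intro finite_support_shift_inter)
  have sumF: "(\<Sum>x\<in>?X. ?F x) = ?E"
    using assms by (intro sum_diag_energy_shift_inter)
  \<comment> \<open>With \<open>l = 0\<close> every summand of \<open>diag_energy\<close> is 1, also
    where \<open>corr\<close> vanishes, since \<open>0 ^ 0 = 1\<close>.\<close>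
  have sum_card: "(\<Sum>x\<in>?X. real (card (?S x)) ^ 2) = energy (k + 1) B A"
    using sum_diag_energy_shift_inter[where A = A and B = B and k = k and l = 0] assms
    by (simp add: diag_energy_def case_prod_unfold card_cartesian_product power2_eq_square)
  have key: "(?N * real (card (?S x))) ^ 2 \<le> ?D x * ?F x" for x
    using assms by (intro card_set_op_diag_ge) (auto simp: shift_inter_def)

  \<comment> \<open>The square root of \<open>key\<close>, multiplied by \<open>card (?S x)\<close>,
    splits into the two factors to which Cauchy--Schwarz is applied below.\<close>
  have "?N * real (card (?S x)) ^ 2 \<le> (real (card (?S x)) * sqrt (?D x)) * sqrt (?F x)" for x
  proof -
    have "?N * real (card (?S x)) \<le> sqrt (?D x * ?F x)"
      using key by (intro real_le_rsqrt)
    then have "real (card (?S x)) * (?N * real (card (?S x))) \<le> real (card (?S x)) * sqrt (?D x * ?F x)"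
      by (intro mult_left_mono) auto
    then show ?thesis by (simp add: power2_eq_square real_sqrt_mult mult_ac)
  qed
  then have "?N * energy (k + 1) B A \<le> (\<Sum>x\<in>?X. (real (card (?S x)) * sqrt (?D x)) * sqrt (?F x))"
    unfolding sum_card[symmetric] sum_distrib_left by (intro sum_mono)
  \<comment> \<open>Nonnegativity allows the inequality to be squared.\<close>
  moreover have "0 \<le> ?N * energy (k + 1) B A"
    unfolding sum_card[symmetric] by (simp add: sum_nonneg)
  ultimately have "(?N * energy (k + 1) B A) ^ 2
      \<le> (\<Sum>x\<in>?X. (real (card (?S x)) * sqrt (?D x)) * sqrt (?F x)) ^ 2"
    by (intro power_mono)
  also have "\<dots> \<le> (\<Sum>x\<in>?X. (real (card (?S x)) * sqrt (?D x)) ^ 2) * (\<Sum>x\<in>?X. sqrt (?F x) ^ 2)"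
    by (rule Cauchy_Schwarz_ineq_sum)
  also have "\<dots> = ?E * (\<Sum>x\<in>?X. ?D x * real (card (?S x)) ^ 2)"
    by (simp add: power_mult_distrib diag_energy_nonneg sumF mult.commute)
  \<comment> \<open>Outside \<open>?X\<close> the set \<open>?S x\<close> is empty and the factor
    \<open>card (?S x) ^ 2\<close> is 0.\<close>
  also have "(\<Sum>x\<in>?X. ?D x * real (card (?S x)) ^ 2)
      = (\<Sum>\<^sub>\<infinity>x\<in>cpow UNIV k. ?D x * real (card (?S x)) ^ 2)"
    unfolding infsum_finite[OF finX, symmetric] by (rule infsum_cong_neutral) auto
  finally have part1: "real (card A) ^ (2 * l) * energy (k + 1) B A ^ 2
      \<le> ?E * (\<Sum>\<^sub>\<infinity>x\<in>cpow UNIV k. ?D x * real (card (?S x)) ^ 2)"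
    by (simp add: power_mult_distrib power_mult mult.commute flip: power_mult)

  have "real (card A) ^ (2 * l) * (real (card (?S x)) ^ 2 / ?D x) \<le> ?F x" for x
  \<comment> \<open>If \<open>?D x = 0\<close>, the quotient is 0 by the convention for division by
    zero.\<close>
  proof (cases "?D x = 0")
    case True
    then show ?thesis by (simp add: diag_energy_nonneg)
  next
    case False
    then have "?D x > 0" by simp
    moreover have "real (card A) ^ (2 * l) * real (card (?S x)) ^ 2 \<le> ?F x * ?D x"
      using key[of x] by (simp add: power_mult_distrib mult.commute flip: power_mult)
    ultimately show ?thesis by (simp add: pos_divide_le_eq)
  qed
  then have "real (card A) ^ (2 * l) * (\<Sum>x\<in>?X. real (card (?S x)) ^ 2 / ?D x) \<le> (\<Sum>x\<in>?X. ?F x)"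
    unfolding sum_distrib_left by (intro sum_mono)
  then have "real (card A) ^ (2 * l) * (\<Sum>\<^sub>\<infinity>x\<in>?X. real (card (?S x)) ^ 2 / ?D x) \<le> ?E"
    using finX by (simp only: infsum_finite sumF)
  with part1 show ?thesis by blast
qed

end
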